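(* For all integers $m \geq 3$ and $n \geq 2$, the tensor product $Fl_m \times K_{1,n}$ of the flower graph $Fl_m$ and the star $K_{1,n}$ admits an antimagic labeling (i.e. is antimagic).
   Context: All graphs are finite, simple and undirected. Antimagic labeling: for a graph $G$ with $q = |E(G)|$ edges, an antimagic labeling is a bijection $f : E(G) \to \{1,2,\dots,q\}$ such that $\phi_f(u) \neq \phi_f(v)$ for all distinct $u,v \in V(G)$, where $\phi_f(u)$ is the sum of the labels $f(e)$ over all edges $e$ incident to $u$. $G$ is antimagic if it admits an antimagic labeling. Tensor product: $G \times H$ has vertex set $V(G) \times V(H)$, and $(x_1,y_1)$ is adjacent to $(x_2,y_2)$ if and only if $x_1x_2 \in E(G)$ and $y_1y_2 \in E(H)$. Star: $K_{1,n}$ is the complete bipartite graph with a central vertex adjacent to each of $n$ other vertices (and no other edges). Wheel: $W_m$ ($m\ge 3$) has vertices $u_0,u_1,\dots,u_m$; the vertices $u_1,\dots,u_m$ form a cycle $C_m$ with edges $u_iu_{i+1}$ ($1\le i\le m-1$) and $u_mu_1$, and the central vertex $u_0$ is adjacent to every $u_i$, $1\le i\le m$. Helm: $H_m$ is obtained from $W_m$ by adding $m$ new vertices $u_{m+1},\dots,u_{2m}$ and the edges $u_iu_{m+i}$ for $1\le i\le m$. Flower: $Fl_m$ is obtained from $H_m$ by adding the edges $u_0u_{m+i}$ for $1\le i\le m$ (so $Fl_m$ has $2m+1$ vertices and $4m$ edges). *)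

theory Defs
  imports Main
begin

text \<open>A graph is a pair of a vertex set and a set of edges, each edge being an unordered pair
  of vertices, represented as a two-element set.\<close>

type_synonym 'a graph = "'a set \<times> 'a set set"

abbreviation verts :: "'a graph \<Rightarrow> 'a set" where
  "verts G \<equiv> fst G"

abbreviation edges :: "'a graph \<Rightarrow> 'a set set" where
  "edges G \<equiv> snd G"

definition simple_graph :: "'a graph \<Rightarrow> bool" where
  "simple_graph G \<longleftrightarrow> finite (verts G) \<and> (\<forall>e\<in>edges G. e \<subseteq> verts G \<and> card e = 2)"

definition vertex_sum :: "'a graph \<Rightarrow> ('a set \<Rightarrow> nat) \<Rightarrow> 'a \<Rightarrow> nat" where
  "vertex_sum G f u = (\<Sum>e\<in>{e \<in> edges G. u \<in> e}. f e)"

definition antimagic_labeling :: "'a graph \<Rightarrow> ('a set \<Rightarrow> nat) \<Rightarrow> bool" where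
  "antimagic_labeling G f \<longleftrightarrow>
     bij_betw f (edges G) {1..card (edges G)} \<and>
     (\<forall>u\<in>verts G. \<forall>v\<in>verts G. u \<noteq> v \<longrightarrow> vertex_sum G f u \<noteq> vertex_sum G f v)"

definition antimagic :: "'a graph \<Rightarrow> bool" where
  "antimagic G \<longleftrightarrow> (\<exists>f. antimagic_labeling G f)"

definition tensor_product :: "'a graph \<Rightarrow> 'b graph \<Rightarrow> ('a \<times> 'b) graph" where
  "tensor_product G H =
     (verts G \<times> verts H,
      {{(x1, y1), (x2, y2)} | x1 y1 x2 y2. {x1, x2} \<in> edges G \<and> {y1, y2} \<in> edges H})"

text \<open>In the families below the vertex \<open>u\<^sub>i\<close> is represented by the number \<open>i\<close>;
  the centre is \<open>0\<close>.\<close>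

definition star :: "nat \<Rightarrow> nat graph" where
  "star n = ({0..n}, {{0, i} | i. i \<in> {1..n}})"

definition wheel :: "nat \<Rightarrow> nat graph" where
  "wheel m = ({0..m},
     {{i, i + 1} | i. i \<in> {1..m - 1}} \<union> {{m, 1}} \<union> {{0, i} | i. i \<in> {1..m}})"

definition helm :: "nat \<Rightarrow> nat graph" where
  "helm m = (verts (wheel m) \<union> {m + 1..2 * m},
     edges (wheel m) \<union> {{i, m + i} | i. i \<in> {1..m}})"

definition flower :: "nat \<Rightarrow> nat graph" where
  "flower m = (verts (helm m), edges (helm m) \<union> {{0, m + i} | i. i \<in> {1..m}})"

lemma simple_graph_tensor_product:
  assumes "simple_graph G" "simple_graph H"
  shows "simple_graph (tensor_product G H)"
proof -
  have "{(x1, y1), (x2, y2)} \<subseteq> verts G \<times> verts H \<and> card {(x1, y1), (x2, y2)} = 2"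
    if "{x1, x2} \<in> edges G" "{y1, y2} \<in> edges H" for x1 x2 y1 y2
  proof -
    have "{x1, x2} \<subseteq> verts G" "card {x1, x2} = 2" "{y1, y2} \<subseteq> verts H"
      using assms that unfolding simple_graph_def by blast+
    then show ?thesis by (cases "x1 = x2") auto
  qed
  then show ?thesis
    using assms unfolding simple_graph_def tensor_product_def by auto
qed

lemma tensor_product_adj_iff:
  "{(x1, y1), (x2, y2)} \<in> edges (tensor_product G H) \<longleftrightarrow>
     {x1, x2} \<in> edges G \<and> {y1, y2} \<in> edges H"
  unfolding tensor_product_def by (auto simp: doubleton_eq_iff insert_commute)

lemma simple_graph_star: "simple_graph (star n)"
  unfolding simple_graph_def star_def by (auto simp: card_2_iff)

lemma simple_graph_flower: "m \<ge> 3 \<Longrightarrow> simple_graph (flower m)"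
  unfolding simple_graph_def flower_def helm_def wheel_def by (auto simp: card_insert_if)

lemma card_verts_flower: "card (verts (flower m)) = 2 * m + 1"
proof -
  have "verts (flower m) = {0..2 * m}"
    by (auto simp: flower_def helm_def wheel_def)
  then show ?thesis by simp
qed

lemma card_edges_flower:
  assumes "m \<ge> 3"
  shows "card (edges (flower m)) = 4 * m"
proof -
  let ?A = "(\<lambda>i::nat. {i, i + 1}) ` {1..m - 1}" and ?B = "{{m, 1::nat}}"
  let ?C = "(\<lambda>i::nat. {0, i}) ` {1..2 * m}" and ?D = "(\<lambda>i::nat. {i, m + i}) ` {1..m}"
  have eq: "edges (flower m) = ((?A \<union> ?B) \<union> ?C) \<union> ?D"
  proof -
    have "(\<lambda>i::nat. {0, i}) ` {1..2 * m} =
        {{0, i} | i. i \<in> {1..m}} \<union> {{0, m + i} | i. i \<in> {1..m}}"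
    proof -
      have "{1..2 * m} = {1..m} \<union> (\<lambda>i. m + i) ` {1..m}"
        by (auto simp: image_iff)
      then show ?thesis by (simp only: image_Un image_image) blast
    qed
    then show ?thesis by (auto simp: flower_def helm_def wheel_def)
  qed
  have "card ?A = m - 1" "card ?C = 2 * m" "card ?D = m"
    by (subst card_image; auto simp: inj_on_def doubleton_eq_iff)+
  moreover have "?A \<inter> ?B = {}" "(?A \<union> ?B) \<inter> ?C = {}" "((?A \<union> ?B) \<union> ?C) \<inter> ?D = {}"
    using assms by (auto simp: doubleton_eq_iff)
  ultimately show ?thesis
    unfolding eq using assms by (simp add: card_Un_disjoint)
qed

end

theory Submission
  imports Defs
begin

text \<open>Write \<open>(x, 0)\<close> for the copies of flower vertices over the centre of the star (the base) and
  \<open>(y, j)\<close>, \<open>j \<ge> 1\<close>, for those over its leaves. Every edge of the product joins a base vertex to a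
  leaf vertex, so it is a triple \<open>(x, y, j)\<close> with \<open>x y\<close> an edge of the flower; the \<open>n\<close> triples over
  one ordered pair \<open>(x, y)\<close> form a bundle. There are \<open>8 m n\<close> edges; put \<open>N = m n\<close>.

  The flower has a vertex \<open>0\<close> adjacent to all others. Hence each leaf vertex \<open>(y, j)\<close> with
  \<open>y \<noteq> 0\<close> has exactly one edge to \<open>(0, 0)\<close>, and each base vertex \<open>(x, 0)\<close> with \<open>x \<noteq> 0\<close> exactly one
  bundle to the copies \<open>(0, j)\<close> of the centre. Whatever the labels of the remaining edges,
  handing out the labels of these special edges in the order of the partial sums makes
  the sums distinct within each of the two classes (lemma \<open>ex_ranking\<close>). Giving every bundle
  consecutive labels in the order of \<open>j\<close> makes the sums at \<open>(0, 1), \<dots>, (0, n)\<close> an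
  arithmetic progression, so they differ as well.

  It remains to keep the classes apart, and the order of magnitude of the labels does this.
  The arcs along the rim get the labels up to \<open>2 N\<close>, and the edges at \<open>(0, 0)\<close> those between \<open>4 N\<close> and
  \<open>6 N\<close>. The bundles to the copies of the centre start at \<open>a N\<close> and the bundles between rim and
  outer vertices at \<open>b N\<close>, where \<open>{a, b} = {2, 6}\<close>; each of these two blocks has length \<open>2 N\<close>. Then
  \<^item> sums at leaf vertices \<open>(y, j)\<close> with \<open>y \<noteq> 0\<close> are at most \<open>16 N\<close>;
  \<^item> sums at base vertices \<open>(x, 0)\<close> with \<open>x \<noteq> 0\<close> lie above \<open>8 n N \<ge> 16 N\<close> and are at most \<open>15 n N\<close>;
  \<^item> the sum at \<open>(0, j)\<close> is \<open>((2 a + 2) m - 1) N + 2 m j\<close>, which exceeds \<open>16 N\<close>;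
  \<^item> the sum at \<open>(0, 0)\<close> is at least \<open>8 N N\<close>, which is larger than all others.

  The only comparison that depends on the ratio of \<open>m\<close> and \<open>n\<close> is the one between the base vertices
  and the copies of the centre. The choice of \<open>a\<close> decides it: for \<open>3 m < 4 n\<close> take \<open>a = 2\<close>, which
  puts the copies of the centre at \<open>(6 m + 1) N \<le> 8 n N\<close> or less; otherwise take \<open>a = 6\<close>, which puts
  them above \<open>(14 m - 1) N \<ge> 15 n N\<close>.\<close>

section \<open>Tensor products with a star\<close>

definition nbrs :: "'a graph \<Rightarrow> 'a \<Rightarrow> 'a set" where
  "nbrs G x = {y. {x, y} \<in> edges G}"

text \<open>The edges of the product of \<open>G\<close> with a star, as triples; \<open>triple_edge\<close> reads a triple as an
  edge. The first component is the end over the centre of the star, so both orientations of an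
  edge of \<open>G\<close> occur.\<close>

definition arc_triples :: "'a graph \<Rightarrow> nat \<Rightarrow> ('a \<times> 'a \<times> nat) set" where
  "arc_triples G n = {(x, y, j). y \<in> nbrs G x \<and> j \<in> {1..n}}"

definition triple_edge :: "'a \<times> 'a \<times> nat \<Rightarrow> ('a \<times> nat) set" where
  "triple_edge = (\<lambda>(x, y, j). {(x, 0), (y, j)})"

text \<open>The vertex sum of the product, for a labelling of triples. A vertex over the centre of the star
  meets whole bundles; a vertex over a leaf meets one edge from each bundle that arrives there.\<close>

definition triple_sum :: "'a graph \<Rightarrow> nat \<Rightarrow> ('a \<Rightarrow> 'a \<Rightarrow> nat \<Rightarrow> nat) \<Rightarrow> 'a \<times> nat \<Rightarrow> nat" where
  "triple_sum G n g = (\<lambda>(x, i). if i = 0 then \<Sum>y\<in>nbrs G x. \<Sum>j=1..n. g x y j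
     else \<Sum>y\<in>nbrs G x. g y x i)"

lemma nbrs_sym: "y \<in> nbrs G x \<longleftrightarrow> x \<in> nbrs G y"
  by (simp add: nbrs_def insert_commute)

lemma inj_on_triple_edge: "inj_on triple_edge (arc_triples G n)"
  by (auto simp: inj_on_def triple_edge_def arc_triples_def doubleton_eq_iff)

lemma edges_tensor_star:
  "edges (tensor_product G (star n)) = triple_edge ` arc_triples G n"
proof (intro set_eqI iffI)
  fix e assume "e \<in> edges (tensor_product G (star n))"
  then obtain x1 y1 x2 y2 where e: "e = {(x1, y1), (x2, y2)}" "{x1, x2} \<in> edges G"
    and "{y1, y2} \<in> edges (star n)"
    unfolding tensor_product_def by auto
  then obtain i where i: "i \<in> {1..n}" "y1 = 0 \<and> y2 = i \<or> y1 = i \<and> y2 = 0"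
    by (auto simp: star_def doubleton_eq_iff)
  from i(2) show "e \<in> triple_edge ` arc_triples G n"
  proof
    assume "y1 = 0 \<and> y2 = i"
    then have "e = triple_edge (x1, x2, i)" "(x1, x2, i) \<in> arc_triples G n"
      using e i by (auto simp: triple_edge_def arc_triples_def nbrs_def)
    then show ?thesis by blast
  next
    assume "y1 = i \<and> y2 = 0"
    then have "e = triple_edge (x2, x1, i)" "(x2, x1, i) \<in> arc_triples G n"
      using e i by (auto simp: triple_edge_def arc_triples_def nbrs_def insert_commute)
    then show ?thesis by blast
  qed
next
  fix e assume "e \<in> triple_edge ` arc_triples G n"
  then obtain x y j where e: "e = {(x, 0), (y, j)}" and xy: "{x, y} \<in> edges G"
    and j: "j \<in> {1..n}"
    by (auto simp: triple_edge_def arc_triples_def nbrs_def)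
  have "{0, j} \<in> edges (star n)" using j by (auto simp: star_def)
  then show "e \<in> edges (tensor_product G (star n))"
    using xy by (simp add: e tensor_product_adj_iff)
qed

lemma vertex_sum_tensor_star:
  assumes f: "\<And>x y j. (x, y, j) \<in> arc_triples G n \<Longrightarrow> f (triple_edge (x, y, j)) = g x y j"
    and i: "i \<le> n"
  shows "vertex_sum (tensor_product G (star n)) f (x, i) = triple_sum G n g (x, i)"
proof -
  let ?T = "{t \<in> arc_triples G n. (x, i) \<in> triple_edge t}"
  have "{e \<in> edges (tensor_product G (star n)). (x, i) \<in> e} = triple_edge ` ?T"
    unfolding edges_tensor_star by blast
  then have "vertex_sum (tensor_product G (star n)) f (x, i) = (\<Sum>t\<in>?T. f (triple_edge t))"
    unfolding vertex_sum_def
    by (simp add: sum.reindex inj_on_subset[OF inj_on_triple_edge[of G n]])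
  also have "\<dots> = (\<Sum>(x, y, j)\<in>?T. g x y j)"
    by (rule sum.cong) (auto simp: f)
  also have "\<dots> = triple_sum G n g (x, i)"
  proof (cases "i = 0")
    case True
    have "?T = Pair x ` (nbrs G x \<times> {1..n})"
      by (auto simp: True triple_edge_def arc_triples_def)
    then show ?thesis
      by (simp add: True triple_sum_def sum.reindex inj_on_def sum.cartesian_product
          case_prod_unfold)
  next
    case False
    have "?T = (\<lambda>y. (y, x, i)) ` nbrs G x"
      using False i by (auto simp: triple_edge_def arc_triples_def nbrs_sym)
    then show ?thesis
      using False by (simp add: triple_sum_def sum.reindex inj_on_def)
  qed
  finally show ?thesis .
qed

text \<open>Reduces the claim to a labelling of triples, so that no edge set of the product has to be
  handled afterwards.\<close>

lemma antimagic_tensor_starI: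
  assumes bij: "bij_betw (\<lambda>(x, y, j). g x y j) (arc_triples G n) {1..q}"
    and inj: "inj_on (triple_sum G n g) (verts G \<times> {0..n})"
  shows "antimagic (tensor_product G (star n))"
proof -
  let ?P = "tensor_product G (star n)"
  define f where "f = (\<lambda>(x, y, j). g x y j) \<circ> inv_into (arc_triples G n) triple_edge"
  have f: "f (triple_edge (x, y, j)) = g x y j" if "(x, y, j) \<in> arc_triples G n" for x y j
    using that by (simp add: f_def inv_into_f_f[OF inj_on_triple_edge])
  have "bij_betw (inv_into (arc_triples G n) triple_edge) (edges ?P) (arc_triples G n)"
    unfolding edges_tensor_star
    by (rule bij_betw_inv_into) (simp add: bij_betw_def inj_on_triple_edge)
  then have bij_f: "bij_betw f (edges ?P) {1..q}"
    unfolding f_def using bij by (rule bij_betw_trans)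
  then have "card (edges ?P) = q"
    using bij_betw_same_card by fastforce
  moreover have "vertex_sum ?P f u \<noteq> vertex_sum ?P f v"
    if "u \<in> verts ?P" "v \<in> verts ?P" "u \<noteq> v" for u v
  proof -
    have "verts ?P = verts G \<times> {0..n}"
      by (simp add: tensor_product_def star_def)
    moreover from this have "vertex_sum ?P f w = triple_sum G n g w" if "w \<in> verts ?P" for w
      using that f by (cases w) (auto intro!: vertex_sum_tensor_star)
    ultimately show ?thesis
      using inj that by (metis inj_onD)
  qed
  ultimately show ?thesis
    unfolding antimagic_def antimagic_labeling_def using bij_f by blast
qed

section \<open>Ranking by partial sums\<close>

text \<open>Elements with a larger value of \<open>p\<close> receive a larger rank, so \<open>p\<close> and the rank never pull in
  opposite directions, and ties in \<open>p\<close> are broken by the rank. The factor \<open>c\<close> allows ranks that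
  count bundles instead of single labels.\<close>

lemma ex_ranking:
  fixes p :: "'a \<Rightarrow> nat"
  assumes "finite S"
  obtains r where "bij_betw r S {..<card S}"
    and "\<And>c. c > 0 \<Longrightarrow> inj_on (\<lambda>x. p x + c * r x) S"
proof -
  have "\<exists>r. bij_betw r S {..<card S} \<and> (\<forall>x\<in>S. \<forall>y\<in>S. p x < p y \<longrightarrow> r x < r y)"
    using assms
  proof (induction S rule: finite_ranking_induct[where f = p])
    case empty
    show ?case by (simp add: bij_betw_def)
  next
    case (insert x S)
    then obtain r where r: "bij_betw r S {..<card S}" "\<forall>x\<in>S. \<forall>y\<in>S. p x < p y \<longrightarrow> r x < r y"
      by blast
    show ?case
    proof (cases "x \<in> S")
      case True
      then show ?thesis using r by (auto simp: insert_absorb)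
    next
      case False
      let ?r = "r(x := card S)"
      have "bij_betw ?r S {..<card S}"
        using r(1) False by (metis (no_types, lifting) bij_betw_cong fun_upd_other)
      then have "bij_betw ?r (S \<union> {x}) ({..<card S} \<union> {card S})"
        by (rule bij_betw_combine) (auto simp: bij_betw_def)
      then have "bij_betw ?r (insert x S) {..<card (insert x S)}"
        using insert(1) False by (simp add: lessThan_Suc)
      moreover have "r y < card S" if "y \<in> S" for y
        using r(1) that by (auto simp: bij_betw_def)
      moreover have "\<not> p x < p y" if "y \<in> S" for y
        using insert(2)[OF that] by simp
      ultimately have "bij_betw ?r (insert x S) {..<card (insert x S)} \<and>
          (\<forall>y\<in>insert x S. \<forall>z\<in>insert x S. p y < p z \<longrightarrow> ?r y < ?r z)"
        using r(2) False by simp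
      then show ?thesis by blast
    qed
  qed
  then obtain r where r: "bij_betw r S {..<card S}" "\<forall>x\<in>S. \<forall>y\<in>S. p x < p y \<longrightarrow> r x < r y"
    by blast
  have "inj_on (\<lambda>x. p x + c * r x) S" if "c > 0" for c
  proof (rule inj_onI)
    fix x y assume xy: "x \<in> S" "y \<in> S" "p x + c * r x = p y + c * r y"
    consider "p x < p y" | "p y < p x" | "p x = p y" by linarith
    then have "r x = r y"
    proof cases
      case 1
      then have "r x < r y" using r(2) xy by blast
      then show ?thesis using 1 xy(3) that by (metis add_less_mono mult_less_mono2 less_irrefl)
    next
      case 2
      then have "r y < r x" using r(2) xy by blast
      then show ?thesis using 2 xy(3) that by (metis add_less_mono mult_less_mono2 less_irrefl)
    next
      case 3
      then show ?thesis using xy(3) that by simp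
    qed
    then show "x = y" using r(1) xy(1,2) by (auto simp: bij_betw_def inj_on_def)
  qed
  with r(1) show ?thesis using that by blast
qed

section \<open>Neighbourhoods in the flower graph\<close>

definition rim_next :: "nat \<Rightarrow> nat \<Rightarrow> nat" where
  "rim_next m i = (if i = m then 1 else i + 1)"

definition rim_prev :: "nat \<Rightarrow> nat \<Rightarrow> nat" where
  "rim_prev m i = (if i = 1 then m else i - 1)"

lemma verts_flower: "verts (flower m) = {0..2 * m}"
  by (auto simp: flower_def helm_def wheel_def)

lemma nbrs_flower_centre:
  assumes "m \<ge> 3"
  shows "nbrs (flower m) 0 = {1..2 * m}"
proof (rule set_eqI)
  fix y
  have "y \<in> nbrs (flower m) 0 \<longleftrightarrow>
      (\<exists>i. {0, y} = {0, i} \<and> i \<in> {1..m}) \<or> (\<exists>i. {0, y} = {0, m + i} \<and> i \<in> {1..m})"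
    using assms by (auto simp: nbrs_def flower_def helm_def wheel_def doubleton_eq_iff)
  also have "\<dots> \<longleftrightarrow> y \<in> {1..m} \<or> y - m \<in> {1..m}"
  proof -
    have "{0, y} = {0, k} \<longleftrightarrow> y = k" for k by (auto simp: doubleton_eq_iff)
    moreover have "(\<exists>i. y = m + i \<and> i \<in> {1..m}) \<longleftrightarrow> y - m \<in> {1..m}"
      by (auto intro!: exI[of _ "y - m"])
    ultimately show ?thesis by simp
  qed
  also have "\<dots> \<longleftrightarrow> y \<in> {1..2 * m}" by auto
  finally show "y \<in> nbrs (flower m) 0 \<longleftrightarrow> y \<in> {1..2 * m}" .
qed

lemma nbrs_flower_rim:
  assumes "m \<ge> 3" "i \<in> {1..m}"
  shows "nbrs (flower m) i = {0, m + i, rim_next m i, rim_prev m i}"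
proof (rule set_eqI)
  fix y
  have "(\<exists>k. {i, y} = {k, k + 1} \<and> k \<in> {1..m - 1}) \<longleftrightarrow>
      y = i + 1 \<and> i \<in> {1..m - 1} \<or> i = y + 1 \<and> y \<in> {1..m - 1}"
    unfolding doubleton_eq_iff by blast
  also have "\<dots> \<longleftrightarrow> y = i + 1 \<and> i \<noteq> m \<or> i = y + 1 \<and> y \<noteq> 0"
    using assms by auto
  finally have path: "(\<exists>k. {i, y} = {k, k + 1} \<and> k \<in> {1..m - 1}) \<longleftrightarrow>
      y = i + 1 \<and> i \<noteq> m \<or> i = y + 1 \<and> y \<noteq> 0" .
  have "{i, y} = {m, 1} \<longleftrightarrow> i = m \<and> y = 1 \<or> i = 1 \<and> y = m"
    by (simp add: doubleton_eq_iff)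
  then have cycle: "(y = i + 1 \<and> i \<noteq> m \<or> i = y + 1 \<and> y \<noteq> 0) \<or> {i, y} = {m, 1} \<longleftrightarrow>
      y = rim_next m i \<or> y = rim_prev m i"
    using assms unfolding rim_next_def rim_prev_def by (simp split: if_split) linarith
  have spokes: "(\<exists>k. {i, y} = {0, k} \<and> k \<in> {1..m}) \<longleftrightarrow> y = 0"
    "(\<exists>k. {i, y} = {k, m + k} \<and> k \<in> {1..m}) \<longleftrightarrow> y = m + i"
    "\<not> (\<exists>k. {i, y} = {0, m + k} \<and> k \<in> {1..m})"
    using assms by (auto simp: doubleton_eq_iff)
  show "y \<in> nbrs (flower m) i \<longleftrightarrow> y \<in> {0, m + i, rim_next m i, rim_prev m i}"
    using path cycle spokes
    unfolding nbrs_def flower_def helm_def wheel_def fst_conv snd_conv mem_Collect_eq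
      Un_iff insert_iff empty_iff
    by satx
qed

lemma nbrs_flower_outer:
  assumes "m \<ge> 3" "i \<in> {1..m}"
  shows "nbrs (flower m) (m + i) = {0, i}"
  using assms
  by (auto simp: nbrs_def flower_def helm_def wheel_def doubleton_eq_iff)


lemma rim_facts:
  assumes "m \<ge> 3" "i \<in> {1..m}"
  shows "rim_next m i \<in> {1..m}" "rim_prev m i \<in> {1..m}" "rim_next m i \<noteq> rim_prev m i"
    and "rim_next m (rim_prev m i) = i" "rim_next m (rim_next m i) \<noteq> i"
  using assms by (auto simp: rim_next_def rim_prev_def)

section \<open>Bundles of consecutive labels\<close>

lemma bij_betw_image_source:
  assumes "bij_betw (\<lambda>i. f (h i)) S I"
  shows "bij_betw f (h ` S) I"
  using assms by (auto simp: bij_betw_def inj_on_def image_image)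

lemma bundle_label_quot:
  fixes k n j :: nat
  assumes "j \<in> {1..n}"
  shows "(k * n + j - 1) div n = k" "(k * n + j - 1) mod n = j - 1"
proof -
  have "k * n + j - 1 = (j - 1) + k * n" "j - 1 < n" using assms by auto
  then show "(k * n + j - 1) div n = k" "(k * n + j - 1) mod n = j - 1" by simp_all
qed

text \<open>Numbering the bundles by \<open>F\<close> numbers the edges: bundle \<open>k\<close> occupies the labels from
  \<open>k n + 1\<close> to \<open>k n + n\<close>.\<close>

lemma bij_betw_bundles:
  fixes F :: "'a \<Rightarrow> nat"
  assumes F: "bij_betw F A K" and n: "n > 0"
  shows "bij_betw (\<lambda>(d, j). F d * n + j) (A \<times> {1..n}) {t. t > 0 \<and> (t - 1) div n \<in> K}"
    (is "bij_betw ?L _ _")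
  unfolding bij_betw_def
proof (intro conjI equalityI subsetI inj_onI)
  fix u v assume u: "u \<in> A \<times> {1..n}" and v: "v \<in> A \<times> {1..n}" and eq: "?L u = ?L v"
  obtain d j d' j' where uv: "u = (d, j)" "v = (d', j')" by (metis surj_pair)
  have j: "j \<in> {1..n}" "j' \<in> {1..n}" and d: "d \<in> A" "d' \<in> A"
    using u v uv by simp_all
  have eq': "F d * n + j = F d' * n + j'" using eq uv by simp
  have "F d = F d'" using bundle_label_quot(1)[OF j(1)] bundle_label_quot(1)[OF j(2)] eq' by metis
  moreover from this have "j = j'" using eq' by simp
  ultimately show "u = v"
    using F d uv by (metis bij_betw_imp_inj_on inj_onD)
next
  fix t assume "t \<in> ?L ` (A \<times> {1..n})"
  then obtain d j where t: "t = F d * n + j" "d \<in> A" "j \<in> {1..n}" by force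
  moreover have "F d \<in> K" using F t(2) by (rule bij_betwE[rule_format])
  ultimately show "t \<in> {t. t > 0 \<and> (t - 1) div n \<in> K}"
    using bundle_label_quot(1)[of j n "F d"] by simp
next
  fix t assume t: "t \<in> {t. t > 0 \<and> (t - 1) div n \<in> K}"
  then obtain d where d: "d \<in> A" "F d = (t - 1) div n"
    using F by (metis (no_types, lifting) bij_betw_imp_surj_on imageE mem_Collect_eq)
  have "F d * n + ((t - 1) mod n + 1) = (t - 1) + 1"
    unfolding d(2) add.assoc[symmetric] div_mult_mod_eq ..
  then have "t = ?L (d, (t - 1) mod n + 1)" using t by simp
  moreover have "(t - 1) mod n + 1 \<in> {1..n}"
    using mod_less_divisor[OF n, of "t - 1"] by (simp add: Suc_le_eq)
  ultimately show "t \<in> ?L ` (A \<times> {1..n})" using d(1) by blast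
qed

text \<open>Translates bounds on bundle numbers in units of \<open>m\<close> into bounds on labels in units of \<open>m n\<close>, the
  form in which all magnitudes are compared.\<close>

lemma bundle_label_bounds:
  fixes k :: nat
  assumes "l * m \<le> k" "k < h * m" "j \<in> {1..n}"
  shows "l * (m * n) < k * n + j" "k * n + j \<le> h * (m * n)"
proof -
  have "l * (m * n) \<le> k * n"
    using mult_le_mono1[OF assms(1), of n] by (simp only: mult.assoc)
  then show "l * (m * n) < k * n + j"
    using assms(3) unfolding atLeastAtMost_iff by linarith
  have "(k + 1) * n \<le> h * (m * n)"
    using mult_le_mono1[of "k + 1" "h * m" n] assms(2) unfolding Suc_le_eq[symmetric] Suc_eq_plus1
    by (simp only: mult.assoc)
  then show "k * n + j \<le> h * (m * n)"
    using assms(3) unfolding atLeastAtMost_iff add_mult_distrib mult_1 by linarith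
qed

definition bundle_sum :: "nat \<Rightarrow> nat \<Rightarrow> nat" where
  "bundle_sum n k = (\<Sum>j=1..n. k * n + j)"

lemma bundle_sum_bounds:
  assumes "l * m \<le> k" "k < h * m" "n > 0"
  shows "l * (n * (m * n)) < bundle_sum n k" "bundle_sum n k \<le> h * (n * (m * n))"
proof -
  have "(\<Sum>j=1..n. l * (m * n)) < bundle_sum n k"
    unfolding bundle_sum_def
    by (rule sum_strict_mono) (use assms bundle_label_bounds(1)[OF assms(1,2)] in auto)
  then show "l * (n * (m * n)) < bundle_sum n k" by (simp add: mult.left_commute)
  have "bundle_sum n k \<le> (\<Sum>j=1..n. h * (m * n))"
    unfolding bundle_sum_def
    by (rule sum_mono) (use bundle_label_bounds(2)[OF assms(1,2)] in auto)
  then show "bundle_sum n k \<le> h * (n * (m * n))" by (simp add: mult.left_commute)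
qed

lemma bundle_sum_offset: "bundle_sum n (c + k) = bundle_sum n c + n * n * k"
  by (simp add: bundle_sum_def algebra_simps sum.distrib)

lemma bij_betw_shift: "bij_betw (\<lambda>i. c + (i - 1)) {1..m} {c..<c + m :: nat}"
  by (rule bij_betw_byWitness[where f' = "\<lambda>k. k - c + 1"]) auto

section \<open>The labelling of the flower product\<close>

text \<open>The bundle numbers of all arcs between two vertices other than the centre, in blocks of \<open>m\<close>: from
  an outer vertex to the rim, from the rim to an outer vertex, and along the rim in the two
  directions. They do not involve the ranks, so the partial sums below can be formed before
  the ranks are chosen.\<close>

definition inner_bundle :: "nat \<Rightarrow> nat \<Rightarrow> nat \<Rightarrow> nat \<Rightarrow> nat" where
  "inner_bundle m b x y =
     (if x > m then b * m + (x - m - 1)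
      else if y > m then (b + 1) * m + (x - 1)
      else if y = rim_next m x then x - 1
      else m + (x - 1))"

text \<open>The partial sums at base and leaf vertices, without the edges that come from a copy of the
  centre. These are the quantities to be ranked.\<close>

definition inner_sum_base :: "nat \<Rightarrow> nat \<Rightarrow> nat \<Rightarrow> nat \<Rightarrow> nat" where
  "inner_sum_base m n b x = (\<Sum>y\<in>nbrs (flower m) x - {0}. bundle_sum n (inner_bundle m b x y))"

definition inner_sum_leaf :: "nat \<Rightarrow> nat \<Rightarrow> nat \<Rightarrow> nat \<times> nat \<Rightarrow> nat" where
  "inner_sum_leaf m n b = (\<lambda>(y, j). \<Sum>x\<in>nbrs (flower m) y - {0}. inner_bundle m b x y * n + j)"

text \<open>Here \<open>r\<close> ranks the base vertices and \<open>s\<close> the leaf vertices by their partial sums. The factor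
  \<open>n * n\<close> appears because raising a bundle number by one raises each of its \<open>n\<close> labels by \<open>n\<close>.\<close>

locale flower_labelling =
  fixes m n a b :: nat and r :: "nat \<Rightarrow> nat" and s :: "nat \<times> nat \<Rightarrow> nat"
  assumes m: "m \<ge> 3" and n: "n \<ge> 2"
    and ab: "(a, b) = (if 3 * m < 4 * n then (2, 6) else (6, 2))"
    and r: "bij_betw r {1..2 * m} {..<2 * m}"
    and r_inj: "inj_on (\<lambda>x. inner_sum_base m n b x + n * n * r x) {1..2 * m}"
    and s: "bij_betw s ({1..2 * m} \<times> {1..n}) {..<2 * m * n}"
    and s_inj: "inj_on (\<lambda>u. inner_sum_leaf m n b u + s u) ({1..2 * m} \<times> {1..n})"
begin

definition arc_bundle :: "nat \<Rightarrow> nat \<Rightarrow> nat" where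
  "arc_bundle x y = (if y = 0 then a * m + r x else inner_bundle m b x y)"

definition label :: "nat \<Rightarrow> nat \<Rightarrow> nat \<Rightarrow> nat" where
  "label x y j = (if x = 0 then 4 * (m * n) + (s (y, j) + 1) else arc_bundle x y * n + j)"

abbreviation total :: "nat \<times> nat \<Rightarrow> nat" where
  "total \<equiv> triple_sum (flower m) n label"

lemma ab_cases: "a = 2 \<and> b = 6 \<and> 3 * m < 4 * n \<or> a = 6 \<and> b = 2 \<and> 4 * n \<le> 3 * m"
  using ab by (auto split: if_splits)

lemmas nbrs_centre = nbrs_flower_centre[OF m]
lemmas nbrs_rim = nbrs_flower_rim[OF m]
lemmas nbrs_outer = nbrs_flower_outer[OF m]
lemmas rim = rim_facts[OF m]

lemma noncentral_cases:
  assumes "x \<in> {1..2 * m}"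
  obtains (rim) "x \<in> {1..m}" | (outer) i where "i \<in> {1..m}" "x = m + i"
proof (cases "x \<le> m")
  case True
  then show ?thesis using assms that(1) by simp
next
  case False
  then show ?thesis using assms that(2)[of "x - m"] by auto
qed

lemma arc_bundle_simps:
  assumes "i \<in> {1..m}"
  shows "arc_bundle (m + i) i = b * m + (i - 1)"
    "arc_bundle i (m + i) = (b + 1) * m + (i - 1)"
    "arc_bundle i (rim_next m i) = 0 + (i - 1)"
    "arc_bundle i (rim_prev m i) = m + (i - 1)"
    "arc_bundle (rim_prev m i) i = rim_prev m i - 1"
    "arc_bundle (rim_next m i) i = m + (rim_next m i - 1)"
  using assms rim[OF assms] by (auto simp: arc_bundle_def inner_bundle_def)

text \<open>Each of the five kinds of arcs fills one block of bundle numbers. The gap from \<open>4 * m\<close> to \<open>6 * m\<close> is left for the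
  edges at \<open>(0, 0)\<close>, whose labels are assigned one by one and not in bundles.\<close>

lemma bij_betw_arc_bundle:
  "bij_betw (\<lambda>(x, y). arc_bundle x y) (SIGMA x:{1..2 * m}. nbrs (flower m) x)
     ({0..<4 * m} \<union> {6 * m..<8 * m})"
proof -
  let ?f = "\<lambda>(x, y). arc_bundle x y"
  have *: "bij_betw ?f (h ` {1..m}) {c..<c + m}"
    if "\<And>i. i \<in> {1..m} \<Longrightarrow> ?f (h i) = c + (i - 1)" for h c
    by (intro bij_betw_image_source iffD2[OF bij_betw_cong[OF that] bij_betw_shift])
  have centre: "bij_betw ?f ((\<lambda>x. (x, 0)) ` {1..2 * m}) {a * m..<a * m + 2 * m}"
  proof (rule bij_betw_image_source)
    have "bij_betw (\<lambda>k. a * m + k) {..<2 * m} {a * m..<a * m + 2 * m}"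
      by (rule bij_betw_byWitness[where f' = "\<lambda>k. k - a * m"]) auto
    from bij_betw_trans[OF r this]
    show "bij_betw (\<lambda>x. ?f (x, 0)) {1..2 * m} {a * m..<a * m + 2 * m}"
      by (simp add: arc_bundle_def o_def)
  qed
  have next_arcs: "bij_betw ?f ((\<lambda>i. (i, rim_next m i)) ` {1..m}) {0..<0 + m}"
    and prev_arcs: "bij_betw ?f ((\<lambda>i. (i, rim_prev m i)) ` {1..m}) {m..<m + m}"
    and inward: "bij_betw ?f ((\<lambda>i. (m + i, i)) ` {1..m}) {b * m..<b * m + m}"
    and outward: "bij_betw ?f ((\<lambda>i. (i, m + i)) ` {1..m}) {(b + 1) * m..<(b + 1) * m + m}"
    by (rule *; simp only: arc_bundle_simps prod.case)+
  have "bij_betw ?f ((\<lambda>i. (i, rim_next m i)) ` {1..m} \<union> (\<lambda>i. (i, rim_prev m i)) ` {1..m}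
      \<union> (\<lambda>i. (m + i, i)) ` {1..m} \<union> (\<lambda>i. (i, m + i)) ` {1..m} \<union> (\<lambda>x. (x, 0)) ` {1..2 * m})
    ({0..<0 + m} \<union> {m..<m + m} \<union> {b * m..<b * m + m} \<union> {(b + 1) * m..<(b + 1) * m + m}
      \<union> {a * m..<a * m + 2 * m})"
    using ab_cases
    by (intro bij_betw_combine next_arcs prev_arcs inward outward centre) auto
  also have "{0..<0 + m} \<union> {m..<m + m} \<union> {b * m..<b * m + m} \<union> {(b + 1) * m..<(b + 1) * m + m}
      \<union> {a * m..<a * m + 2 * m} = {0..<4 * m} \<union> {6 * m..<8 * m}"
    using ab_cases by auto
  also have "(\<lambda>i. (i, rim_next m i)) ` {1..m} \<union> (\<lambda>i. (i, rim_prev m i)) ` {1..m}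
      \<union> (\<lambda>i. (m + i, i)) ` {1..m} \<union> (\<lambda>i. (i, m + i)) ` {1..m} \<union> (\<lambda>x. (x, 0)) ` {1..2 * m}
    = (SIGMA x:{1..2 * m}. nbrs (flower m) x)" (is "?L = ?R")
  proof (intro equalityI subsetI)
    fix u assume "u \<in> ?L"
    then show "u \<in> ?R" by (auto simp: nbrs_rim nbrs_outer nbrs_sym[of 0] nbrs_centre)
  next
    fix u assume "u \<in> ?R"
    then obtain x y where u: "u = (x, y)" "x \<in> {1..2 * m}" "y \<in> nbrs (flower m) x" by auto
    from u(2) show "u \<in> ?L"
    proof (cases rule: noncentral_cases)
      case rim
      then show ?thesis using u by (auto simp: nbrs_rim)
    next
      case (outer i)
      then show ?thesis using u by (auto simp: nbrs_outer)
    qed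
  qed
  finally show ?thesis .
qed

lemma bij_betw_label:
  "bij_betw (\<lambda>(x, y, j). label x y j) (arc_triples (flower m) n) {1..8 * (m * n)}"
proof -
  let ?D = "SIGMA x:{1..2 * m}. nbrs (flower m) x" and ?f = "\<lambda>(x, y, j). label x y j"
  let ?K = "{0..<4 * m} \<union> {6 * m..<8 * m}"
  have "bij_betw (\<lambda>u. 4 * (m * n) + (s u + 1)) ({1..2 * m} \<times> {1..n}) {4 * (m * n) <.. 6 * (m * n)}"
  proof -
    have "bij_betw (\<lambda>k. 4 * (m * n) + (k + 1)) {..<2 * m * n} {4 * (m * n) <.. 6 * (m * n)}"
      by (rule bij_betw_byWitness[where f' = "\<lambda>t. t - 4 * (m * n) - 1"]) auto
    from bij_betw_trans[OF s this] show ?thesis by (simp add: o_def)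
  qed
  then have "bij_betw (\<lambda>u. ?f (0, u)) ({1..2 * m} \<times> {1..n}) {4 * (m * n) <.. 6 * (m * n)}"
    by (simp add: label_def case_prod_unfold)
  then have spokes: "bij_betw ?f (Pair 0 ` ({1..2 * m} \<times> {1..n})) {4 * (m * n) <.. 6 * (m * n)}"
    by (rule bij_betw_image_source)
  let ?h = "\<lambda>(d, j). (fst d, snd d, j)"
  have "n > 0" using n by simp
  from bij_betw_bundles[OF bij_betw_arc_bundle this]
  have "bij_betw (\<lambda>u. ?f (?h u)) (?D \<times> {1..n}) {t. t > 0 \<and> (t - 1) div n \<in> ?K}"
    by (rule iffD1[OF bij_betw_cong, rotated]) (auto simp: label_def)
  then have others: "bij_betw ?f (?h ` (?D \<times> {1..n})) {t. t > 0 \<and> (t - 1) div n \<in> ?K}"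
    by (rule bij_betw_image_source)
  have div: "(t - 1) div n < k * m \<longleftrightarrow> t \<le> k * (m * n)" if "t > 0" for t k :: nat
    using that div_less_iff_less_mult[OF \<open>n > 0\<close>, of "t - 1" "k * m"]
    unfolding mult.assoc by linarith
  have K: "{t. t > 0 \<and> (t - 1) div n \<in> ?K} = {0<..4 * (m * n)} \<union> {6 * (m * n)<..8 * (m * n)}"
  proof (rule set_eqI)
    fix t
    have "(t - 1) div n \<in> ?K \<longleftrightarrow> t \<in> {0<..4 * (m * n)} \<union> {6 * (m * n)<..8 * (m * n)}" if "t > 0"
      unfolding Un_iff atLeastLessThan_iff greaterThanAtMost_iff
      using div[OF that, of 4] div[OF that, of 6] div[OF that, of 8] that by linarith
    then show "t \<in> {t. t > 0 \<and> (t - 1) div n \<in> ?K}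
        \<longleftrightarrow> t \<in> {0<..4 * (m * n)} \<union> {6 * (m * n)<..8 * (m * n)}"
      by auto
  qed
  have "bij_betw ?f (Pair 0 ` ({1..2 * m} \<times> {1..n}) \<union> ?h ` (?D \<times> {1..n}))
      ({4 * (m * n) <.. 6 * (m * n)} \<union> ({0<..4 * (m * n)} \<union> {6 * (m * n)<..8 * (m * n)}))"
    using others unfolding K by (intro bij_betw_combine spokes) auto
  also have "{4 * (m * n) <.. 6 * (m * n)} \<union> ({0<..4 * (m * n)} \<union> {6 * (m * n)<..8 * (m * n)})
      = {1..8 * (m * n)}"
    by auto
  also have "Pair 0 ` ({1..2 * m} \<times> {1..n}) \<union> ?h ` (?D \<times> {1..n}) = arc_triples (flower m) n"
  proof -
    have "x \<le> 2 * m" if "y \<in> nbrs (flower m) x" for x y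
      using that m by (auto simp: nbrs_def flower_def helm_def wheel_def doubleton_eq_iff)
    then have source: "x = 0 \<or> x \<in> {1..2 * m}" if "y \<in> nbrs (flower m) x" for x y
      using that by fastforce
    show ?thesis
    proof (rule set_eqI)
      fix t :: "nat \<times> nat \<times> nat"
      obtain x y j where t: "t = (x, y, j)" by (metis surj_pair)
      have "t \<in> Pair 0 ` ({1..2 * m} \<times> {1..n}) \<longleftrightarrow>
          x = 0 \<and> y \<in> nbrs (flower m) 0 \<and> j \<in> {1..n}"
        unfolding t nbrs_centre by blast
      moreover have "t \<in> ?h ` (?D \<times> {1..n}) \<longleftrightarrow>
          x \<in> {1..2 * m} \<and> y \<in> nbrs (flower m) x \<and> j \<in> {1..n}"
        unfolding t by (force simp del: atLeastAtMost_iff)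
      ultimately show "t \<in> Pair 0 ` ({1..2 * m} \<times> {1..n}) \<union> ?h ` (?D \<times> {1..n})
          \<longleftrightarrow> t \<in> arc_triples (flower m) n"
        using source unfolding arc_triples_def t Un_iff mem_Collect_eq prod.case by blast
    qed
  qed
  finally show ?thesis .
qed


lemma total_base:
  assumes "x \<noteq> 0"
  shows "total (x, 0) = (\<Sum>y\<in>nbrs (flower m) x. bundle_sum n (arc_bundle x y))"
  using assms by (simp add: triple_sum_def label_def bundle_sum_def)

lemma noncentral_nbrs:
  assumes "x \<in> {1..2 * m}"
  shows "finite (nbrs (flower m) x)" "0 \<in> nbrs (flower m) x"
  by (rule noncentral_cases[OF assms]; simp only: nbrs_rim nbrs_outer; simp)+

text \<open>At a base vertex the bundle to the copies of the centre is the only one that depends on the rank,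
  so the total is the ranked quantity plus a constant; the same holds at a leaf vertex below.\<close>

lemma inj_on_total_base: "inj_on total ({1..2 * m} \<times> {0})"
proof -
  have total: "total (x, 0) = inner_sum_base m n b x + n * n * r x + bundle_sum n (a * m)"
    if x: "x \<in> {1..2 * m}" for x
  proof -
    have "total (x, 0) = bundle_sum n (a * m + r x)
        + (\<Sum>y\<in>nbrs (flower m) x - {0}. bundle_sum n (arc_bundle x y))"
      using noncentral_nbrs[OF x] x by (simp add: total_base sum.remove arc_bundle_def)
    also have "(\<Sum>y\<in>nbrs (flower m) x - {0}. bundle_sum n (arc_bundle x y)) = inner_sum_base m n b x"
      unfolding inner_sum_base_def by (rule sum.cong) (auto simp: arc_bundle_def)
    finally show ?thesis by (simp add: bundle_sum_offset)
  qed
  show ?thesis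
  proof (rule inj_onI)
    fix u v assume "u \<in> {1..2 * m} \<times> {0}" "v \<in> {1..2 * m} \<times> {0::nat}" and eq: "total u = total v"
    then obtain x y where uv: "u = (x, 0)" "v = (y, 0)" "x \<in> {1..2 * m}" "y \<in> {1..2 * m}"
      by auto
    have "x = y"
      using inj_onD[OF r_inj _ uv(3,4)] eq uv total[OF uv(3)] total[OF uv(4)] by simp
    then show "u = v" using uv by simp
  qed
qed

lemma inj_on_total_leaf: "inj_on total ({1..2 * m} \<times> {1..n})"
proof -
  have total: "total u = inner_sum_leaf m n b u + s u + (4 * (m * n) + 1)"
    if u_in: "u \<in> {1..2 * m} \<times> {1..n}" for u
  proof -
    obtain y j where u: "u = (y, j)" "y \<in> {1..2 * m}" "j \<in> {1..n}"
      using u_in by blast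
    have "total u = label 0 y j + (\<Sum>x\<in>nbrs (flower m) y - {0}. label x y j)"
      using noncentral_nbrs[OF u(2)] u by (simp add: triple_sum_def sum.remove)
    also have "(\<Sum>x\<in>nbrs (flower m) y - {0}. label x y j) = inner_sum_leaf m n b u"
      unfolding inner_sum_leaf_def u prod.case
      by (rule sum.cong) (use u in \<open>auto simp: label_def arc_bundle_def\<close>)
    also have "label 0 y j = s u + (4 * (m * n) + 1)" by (simp add: label_def u)
    finally show ?thesis by simp
  qed
  show ?thesis
  proof (rule inj_onI)
    fix u v assume uv: "u \<in> {1..2 * m} \<times> {1..n}" "v \<in> {1..2 * m} \<times> {1..n}"
      and "total u = total v"
    then have "inner_sum_leaf m n b u + s u = inner_sum_leaf m n b v + s v"
      using total[OF uv(1)] total[OF uv(2)] by linarith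
    then show "u = v" by (rule inj_onD[OF s_inj _ uv])
  qed
qed

lemma r_less: "x \<in> {1..2 * m} \<Longrightarrow> r x < 2 * m"
  using r by (auto simp: bij_betw_def)

lemma s_less: "u \<in> {1..2 * m} \<times> {1..n} \<Longrightarrow> s u < 2 * (m * n)"
  using s by (auto simp: bij_betw_def mult.assoc simp del: atLeastAtMost_iff)

lemma arc_bundle_bounds:
  assumes "i \<in> {1..m}"
  shows "b * m \<le> arc_bundle (m + i) i" "arc_bundle (m + i) i < (b + 1) * m"
    "(b + 1) * m \<le> arc_bundle i (m + i)" "arc_bundle i (m + i) < (b + 2) * m"
    "arc_bundle i (rim_next m i) < 1 * m" "arc_bundle i (rim_prev m i) < 2 * m"
    "arc_bundle (rim_prev m i) i < 1 * m" "arc_bundle (rim_next m i) i < 2 * m"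
  unfolding arc_bundle_simps[OF assms] add_mult_distrib
  using assms rim(1,2)[OF assms] by auto

lemma arc_bundle_centre_bounds:
  assumes "x \<in> {1..2 * m}"
  shows "a * m \<le> arc_bundle x 0" "arc_bundle x 0 < (a + 2) * m"
  using r_less[OF assms] by (auto simp: arc_bundle_def algebra_simps)

text \<open>Both block orders give the same bounds, because the block of the centre and the block of the outer
  vertices enter symmetrically and \<open>a + b = 8\<close>. An outer vertex has one bundle in each of the two; a
  rim vertex has in addition two bundles along the rim, below \<open>1 * m\<close> and \<open>2 * m\<close>.\<close>

lemma total_base_bounds:
  assumes "x \<in> {1..2 * m}"
  shows "8 * (n * (m * n)) < total (x, 0)" "total (x, 0) \<le> 15 * (n * (m * n))"
proof -
  let ?M = "n * (m * n)"
  have n0: "n > 0" using n by simp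
  have ab8: "a * ?M + b * ?M = 8 * ?M" using ab_cases by auto
  note bounds = bundle_sum_bounds[OF _ _ n0]
  note c = bounds[OF arc_bundle_centre_bounds[OF assms]]
  have "8 * ?M < total (x, 0) \<and> total (x, 0) \<le> 15 * ?M"
    using assms
  proof (cases rule: noncentral_cases)
    case rim
    note B = arc_bundle_bounds[OF rim]
    have "total (x, 0) = bundle_sum n (arc_bundle x 0) + bundle_sum n (arc_bundle x (m + x))
        + bundle_sum n (arc_bundle x (rim_next m x)) + bundle_sum n (arc_bundle x (rim_prev m x))"
      using rim rim_facts[OF m rim] by (simp add: total_base nbrs_rim)
    then show ?thesis
      using c bounds[OF B(3,4)] bounds(2)[OF _ B(5), of 0] bounds(2)[OF _ B(6), of 0] ab8
      unfolding add_mult_distrib by linarith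
  next
    case (outer i)
    note B = arc_bundle_bounds[OF outer(1)]
    have "total (x, 0) = bundle_sum n (arc_bundle x 0) + bundle_sum n (arc_bundle x i)"
      using outer by (simp add: total_base nbrs_outer)
    then show ?thesis
      using c bounds[OF B(1,2)] ab8 unfolding outer(2) add_mult_distrib by linarith
  qed
  then show "8 * ?M < total (x, 0)" "total (x, 0) \<le> 15 * ?M" by simp_all
qed

text \<open>A rim vertex is the extreme case: at most \<open>6\<close> units from \<open>(0, 0)\<close>, \<open>b + 1 \<le> 7\<close> from its outer
  vertex, and \<open>1\<close> and \<open>2\<close> from its two neighbours on the rim.\<close>

lemma total_leaf_bound:
  assumes y: "y \<in> {1..2 * m}" and j: "j \<in> {1..n}"
  shows "total (y, j) \<le> 16 * (m * n)"
proof -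
  let ?N = "m * n"
  have j0: "j \<noteq> 0" using j by simp
  have b6: "b * ?N \<le> 6 * ?N" using ab_cases by auto
  have c: "label 0 y j \<le> 6 * ?N"
    using s_less[of "(y, j)"] y j by (simp add: label_def)
  note bound = bundle_label_bounds(2)[OF _ _ j, where l = 0]
  show ?thesis
    using y
  proof (cases rule: noncentral_cases)
    case rim
    note B = arc_bundle_bounds[OF rim]
    have "total (y, j) = label 0 y j + label (m + y) y j + label (rim_next m y) y j
        + label (rim_prev m y) y j"
      using rim rim_facts[OF m rim] j0 by (simp add: triple_sum_def nbrs_rim)
    also have "\<dots> = label 0 y j + (arc_bundle (m + y) y * n + j)
        + (arc_bundle (rim_next m y) y * n + j) + (arc_bundle (rim_prev m y) y * n + j)"
      using rim rim_facts(1,2)[OF m rim] by (simp add: label_def)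
    finally show ?thesis
      using c b6 bound[OF _ B(2)] bound[OF _ B(7)] bound[OF _ B(8)]
      unfolding add_mult_distrib by linarith
  next
    case (outer i)
    note B = arc_bundle_bounds[OF outer(1)]
    have "total (y, j) = label 0 y j + (arc_bundle i y * n + j)"
      using outer j0 by (simp add: triple_sum_def nbrs_outer label_def)
    then show ?thesis
      using c b6 bound[OF _ B(4)] unfolding add_mult_distrib outer(2) by linarith
  qed
qed

text \<open>The bundles at the copies of the centre occupy one complete block, so the sum does not depend on
  the ranking. The term \<open>m * n\<close> on the left avoids a subtraction of natural numbers.\<close>

lemma total_centre_leaf:
  assumes j: "j \<in> {1..n}"
  shows "total (0, j) + m * n = (2 * a + 2) * m * (m * n) + 2 * m * j"
proof -
  let ?R = "\<Sum>x\<in>{1..2 * m}. r x"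
  have "2 * (\<Sum>i<k. i) + k = k * k" for k :: nat
    by (induction k) simp_all
  from this[of "2 * m"] have "2 * (\<Sum>i<2 * m. i) + 2 * m = 2 * (2 * m * m)" by simp
  moreover have "?R = (\<Sum>k<2 * m. k)"
    using sum.reindex_bij_betw[OF r, of "\<lambda>k. k"] .
  ultimately have ranks: "?R + m = 2 * m * m" by linarith
  have "total (0, j) = (\<Sum>x\<in>{1..2 * m}. (a * m * n + j) + r x * n)"
    using j unfolding triple_sum_def prod.case nbrs_centre
    by (auto simp: label_def arc_bundle_def add_mult_distrib intro!: sum.cong)
  also have "\<dots> = 2 * m * (a * m * n + j) + ?R * n"
    unfolding sum.distrib sum_distrib_right by (simp add: add_mult_distrib2)
  finally have "total (0, j) + m * n = 2 * m * (a * m * n + j) + (?R + m) * n"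
    unfolding add_mult_distrib by linarith
  then show ?thesis unfolding ranks by (simp add: algebra_simps)
qed

lemma inj_on_total_centre_leaf: "inj_on total ({0} \<times> {1..n})"
proof (rule inj_onI)
  fix u v assume "u \<in> {0::nat} \<times> {1..n}" "v \<in> {0::nat} \<times> {1..n}" and eq: "total u = total v"
  then obtain i j where uv: "u = (0, i)" "v = (0, j)" "i \<in> {1..n}" "j \<in> {1..n}" by auto
  have "2 * m * i = 2 * m * j"
    using total_centre_leaf[OF uv(3)] total_centre_leaf[OF uv(4)] eq[unfolded uv(1,2)] by linarith
  then show "u = v" using m uv by simp
qed

text \<open>The last claim is where the choice of \<open>a\<close> matters: the sum at \<open>(0, j)\<close> has order \<open>m * m * n\<close>, those at
  base vertices \<open>m * n * n\<close>, and neither dominates for all \<open>m\<close> and \<open>n\<close>.\<close>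

lemma total_centre_leaf_bounds:
  assumes j: "j \<in> {1..n}"
  shows "16 * (m * n) < total (0, j)" "total (0, j) < 8 * (m * n) * (m * n)"
    and "x \<in> {1..2 * m} \<Longrightarrow> total (0, j) \<noteq> total (x, 0)"
proof -
  let ?N = "m * n"
  note T = total_centre_leaf[OF j]
  have N: "?N > 0" using m n by simp
  have mj: "0 < 2 * m * j" "2 * m * j \<le> 2 * ?N" using m j by auto
  \<comment> \<open>The extreme case is \<open>a = 2\<close> and \<open>m = 3\<close>.\<close>
  have "18 * ?N \<le> (2 * a + 2) * m * ?N"
  proof -
    have "6 * 3 \<le> (2 * a + 2) * m" using m ab_cases by (intro mult_mono) auto
    from mult_le_mono1[OF this, of ?N] show ?thesis by simp
  qed
  then show "16 * ?N < total (0, j)" using T mj N by linarith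
  have "(2 * a + 2) * m * ?N + 2 * ?N \<le> 8 * ?N * ?N"
  proof -
    have "(2 * a + 2) * m + 2 \<le> 16 * m" using m ab_cases by auto
    also have "\<dots> \<le> 8 * ?N" using n by simp
    finally have "((2 * a + 2) * m + 2) * ?N \<le> 8 * ?N * ?N" by (rule mult_le_mono1)
    then show ?thesis unfolding add_mult_distrib .
  qed
  then show "total (0, j) < 8 * ?N * ?N" using T mj N by linarith
  assume x: "x \<in> {1..2 * m}"
  note A = total_base_bounds[OF x]
  show "total (0, j) \<noteq> total (x, 0)"
  proof (cases "3 * m < 4 * n")
    case True
    then have a: "a = 2" using ab by simp
    from True have "(6 * m + 1) * ?N \<le> 8 * n * ?N" by (intro mult_le_mono1) linarith
    moreover have "total (0, j) + ?N = 6 * m * ?N + 2 * m * j"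
      using T a by simp
    ultimately show ?thesis
      using mj A(1) unfolding add_mult_distrib mult.assoc by linarith
  next
    case False
    then have a: "a = 6" using ab by simp
    from False have "(15 * n + 1) * ?N \<le> 14 * m * ?N" using n by (intro mult_le_mono1) linarith
    moreover have "total (0, j) + ?N = 14 * m * ?N + 2 * m * j"
      using T a by simp
    ultimately show ?thesis
      using mj A(2) unfolding add_mult_distrib mult.assoc by linarith
  qed
qed

lemma total_hub: "8 * (m * n) * (m * n) \<le> total (0, 0)"
proof -
  have "8 * (m * n) * (m * n) = (\<Sum>y\<in>{1..2 * m}. \<Sum>j=1..n. 4 * (m * n))" by simp
  also have "\<dots> \<le> (\<Sum>y\<in>{1..2 * m}. \<Sum>j=1..n. label 0 y j)"
    by (intro sum_mono) (simp add: label_def)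
  also have "\<dots> = total (0, 0)"
    unfolding triple_sum_def prod.case nbrs_centre by simp
  finally show ?thesis .
qed

lemma inj_on_total: "inj_on total ({0..2 * m} \<times> {0..n})"
proof -
  have base_leaf: "total (x, 0) \<noteq> total (y, j)"
    if "x \<in> {1..2 * m}" "y \<in> {1..2 * m}" "j \<in> {1..n}" for x y j
  proof -
    have "16 * (m * n) \<le> 8 * (n * (m * n))" using n by simp
    then show ?thesis
      using total_base_bounds(1)[OF that(1)] total_leaf_bound[OF that(2,3)] by linarith
  qed
  have leaf_centre: "total (y, j) < total (0, k)"
    if "y \<in> {1..2 * m}" "j \<in> {1..n}" "k \<in> {1..n}" for y j k
    using total_leaf_bound[OF that(1,2)] total_centre_leaf_bounds(1)[OF that(3)] by linarith
  have hub_centre: "total (0, k) < total (0, 0)" if "k \<in> {1..n}" for k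
    using total_centre_leaf_bounds(2)[OF that] total_hub by linarith
  have hub_base: "total (x, 0) < total (0, 0)" if "x \<in> {1..2 * m}" for x
  proof -
    have "15 * (n * (m * n)) < 8 * (m * n) * (m * n)" using m n by simp
    then show ?thesis using total_base_bounds(2)[OF that] total_hub by linarith
  qed
  have hub_leaf: "total (y, j) < total (0, 0)" if "y \<in> {1..2 * m}" "j \<in> {1..n}" for y j
    using leaf_centre[OF that that(2)] hub_centre[OF that(2)] by linarith
  have "{0..2 * m} \<times> {0..n} = {(0, 0)} \<union> {0} \<times> {1..n} \<union> {1..2 * m} \<times> {0} \<union> {1..2 * m} \<times> {1..n}"
    by auto
  moreover have "inj_on total ({(0, 0)} \<union> {0} \<times> {1..n} \<union> {1..2 * m} \<times> {0} \<union> {1..2 * m} \<times> {1..n})"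
    unfolding inj_on_Un
    using inj_on_total_base inj_on_total_leaf inj_on_total_centre_leaf
      base_leaf leaf_centre hub_centre hub_base hub_leaf total_centre_leaf_bounds(3)
    by (fastforce simp del: atLeastAtMost_iff)
  ultimately show ?thesis by simp
qed

end

section \<open>Flower graphs times stars\<close>

theorem theorem12:
  fixes m n :: nat
  assumes "m \<ge> 3" and "n \<ge> 2"
  shows "antimagic (tensor_product (flower m) (star n))"
proof -
  define a b :: nat where "a = (if 3 * m < 4 * n then 2 else 6)" and "b = 8 - a"
  obtain r where r: "bij_betw r {1..2 * m} {..<card {1..2 * m}}"
    "\<And>c. c > 0 \<Longrightarrow> inj_on (\<lambda>x. inner_sum_base m n b x + c * r x) {1..2 * m}"
    using ex_ranking[of "{1..2 * m}"] by blast
  obtain s where s: "bij_betw s ({1..2 * m} \<times> {1..n}) {..<card ({1..2 * m} \<times> {1..n})}"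
    "\<And>c. c > 0 \<Longrightarrow> inj_on (\<lambda>u. inner_sum_leaf m n b u + c * s u) ({1..2 * m} \<times> {1..n})"
    using ex_ranking[of "{1..2 * m} \<times> {1..n}"] by blast
  interpret flower_labelling m n a b r s
  proof
    show "(a, b) = (if 3 * m < 4 * n then (2, 6) else (6, 2))"
      by (simp add: a_def b_def)
    show "inj_on (\<lambda>x. inner_sum_base m n b x + n * n * r x) {1..2 * m}"
      using r(2)[of "n * n"] assms by simp
    show "inj_on (\<lambda>u. inner_sum_leaf m n b u + s u) ({1..2 * m} \<times> {1..n})"
      using s(2)[of 1] by simp
  qed (use assms r(1) s(1) in \<open>simp_all add: card_cartesian_product\<close>)
  show ?thesis
    using bij_betw_label inj_on_total
    by (intro antimagic_tensor_starI) (simp_all add: verts_flower)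
qed

end
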